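(* Let $(A,\ast,\circ)$ be an anti-pre-Poisson algebra and let $r=\sum_i a_i\otimes b_i\in A\otimes A$ be skew-symmetric (i.e. $\tau(r)=-r$). Define $\Delta_r,\delta_r:A\to A\otimes A$ by $\Delta_r(x)=-(I\otimes L_\star(x)+L_\ast(x)\otimes I)r$ and $\delta_r(x)=(L_\circ(x)\otimes I-I\otimes\mathrm{ad}(x))r$. If $S(r)=D(r)=0$, then $(A,\ast,\circ,\Delta_r,\delta_r)$ is an anti-pre-Poisson bialgebra.
   Context: Throughout, $k$ is a field and all vector spaces and algebras are finite-dimensional over $k$. Algebras. An anti-Zinbiel algebra $(A,\ast)$ is a vector space with a bilinear operation such that $x\ast(y\ast z)=-(x\ast y+y\ast x)\ast z=-(y\ast z+z\ast y)\ast x=z\ast(y\ast x)$ and $z\ast(x\ast y)=x\ast(z\ast y)$ for all $x,y,z$. An anti-pre-Lie algebra $(A,\circ)$ is a vector space with a bilinear operation such that, with $[x,y]=x\circ y-y\circ x$, $x\circ(y\circ z)-y\circ(x\circ z)=[y,x]\circ z$ and $[x,y]\circ z+[y,z]\circ x+[z,x]\circ y=0$. An anti-pre-Poisson algebra $(A,\ast,\circ)$ consists of an anti-Zinbiel algebra $(A,\ast)$ and an anti-pre-Lie algebra $(A,\circ)$ with $(x\circ y-y\circ x)\ast z=y\ast(x\circ z)-x\circ(y\ast z)$, $(x\ast y+y\ast x)\circ z=-x\ast(y\circ z)-y\ast(x\circ z)$, and $z\circ(x\ast y+y\ast x)+x\ast(y\circ z)+y\ast(x\circ z)=x\ast(z\circ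 y)+y\ast(z\circ x)$. Put $x\star y=x\ast y+y\ast x$. Operators. $L_\ast(x)y=x\ast y$, $R_\ast(x)y=y\ast x$ (similarly for other operations), $\mathrm{ad}(x)=L_\circ(x)-R_\circ(x)$, $L_\star=L_\ast+R_\ast$. $\tau(x\otimes y)=y\otimes x$; $I$ is the identity. Yang-Baxter expressions: $D(r)=r_{12}\ast r_{23}-r_{12}\ast r_{13}+r_{13}\star r_{23}=\sum_{i,j}\big(a_i\otimes b_i\ast a_j\otimes b_j-a_i\ast a_j\otimes b_i\otimes b_j+a_i\otimes a_j\otimes b_i\star b_j\big)$ and $S(r)=r_{12}\circ r_{13}+r_{12}\circ r_{23}-[r_{13},r_{23}]=\sum_{i,j}\big(a_i\circ a_j\otimes b_i\otimes b_j+a_i\otimes b_i\circ a_j\otimes b_j-a_i\otimes a_j\otimes[b_i,b_j]\big)$. (The pair of equations $D(r)=0$, $S(r)=0$ is the anti-pre-Poisson Yang-Baxter equation, APP-YBE.) Anti-pre-Poisson bialgebra $(A,\ast,\circ,\Delta,\delta)$: $(A,\ast,\circ)$ is an anti-pre-Poisson algebra; $(A,\Delta,\delta)$ is an anti-pre-Poisson coalgebra, i.e. (equivalently) the operations on $A^*$ dual to $\Delta$ and $\delta$ (so $\langle\Delta(x),\zeta\otimes\eta\rangle=\langle x,\zeta\ast\eta\rangle$, $\langle\delta(x),\zeta\otimes\eta\rangle=\langle x,\zeta\circ\eta\rangle$) make $A^*$ an anti-pre-Poisson algebra; and for all $x,y\in A$: (1) $\Delta(x\star y)=(I\otimes L_\star(x))\Delta(y)-(L_\ast(y)\otimes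 I)\Delta(x)$; (2) $(\Delta+\tau\Delta)(x\ast y)=(L_\ast(x)\otimes I)(\Delta+\tau\Delta)(y)-(I\otimes R_\ast(y))\Delta(x)$; (3) $\delta([x,y])=(I\otimes\mathrm{ad}(x)-L_\circ(x)\otimes I)\delta(y)-(I\otimes\mathrm{ad}(y)-L_\circ(y)\otimes I)\delta(x)$; (4) $(I\otimes I-\tau)\big(\delta(x\circ y)-(L_\circ(x)\otimes I)\delta(y)-(I\otimes L_\circ(x))\delta(y)+(I\otimes R_\circ(y))\delta(x)\big)=0$; (5) $\delta(x\star y)=(I\otimes L_\star(x))\delta(y)+(I\otimes L_\star(y))\delta(x)+(L_\circ(x)\otimes I)\Delta(y)+(L_\circ(y)\otimes I)\Delta(x)$; (6) $\Delta([x,y])=-(L_\circ(x)\otimes I)\Delta(y)-(I\otimes L_\star(y))\delta(x)-(L_\ast(y)\otimes I)\delta(x)+(I\otimes\mathrm{ad}(x))\Delta(y)$; (7) $(\Delta+\tau\Delta)(x\circ y)=(I\otimes I+\tau)\big((L_\circ(x)\otimes I)\Delta(y)+(I\otimes L_\circ(x))\Delta(y)+(I\otimes R_\ast(y))\delta(x)\big)$; (8) $\delta(x\ast y)-\tau\delta(x\ast y)=(I\otimes L_\ast(x))\delta(y)-\tau(L_\ast(x)\otimes I)\delta(y)-(L_\circ(x)\otimes I)\Delta(y)-\tau(I\otimes L_\circ(x))\Delta(y)-(I\otimes R_\ast(y))\delta(x)-\tau(I\otimes R_\circ(y))\Delta(x)$. *)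

theory Defs
  imports Complex_Main "HOL-Library.Function_Algebras"
begin

section \<open>Tensor products of a vector space with itself\<close>

text \<open>
  A vector space over a field is given by its scalar multiplication \<open>s\<close> on a type
  (locale \<^locale>\<open>vector_space\<close>). A pure tensor \<open>x \<otimes> y\<close> is realised as the bilinear function
  \<open>(\<zeta>, \<eta>) \<mapsto> \<zeta> x * \<eta> y\<close> on pairs of linear functionals, so that \<open>t \<zeta> \<eta>\<close> is the pairing
  \<open>\<langle>t, \<zeta> \<otimes> \<eta>\<rangle>\<close>; the value is 0 on functions that are not linear functionals, which makes equality of
  tensors the HOL equality. The tensor square is the span of the pure tensors. It is proved below
  to have the universal property of the tensor product, and likewise for the tensor cube.
\<close>

definition dual :: "('k::field \<Rightarrow> 'a::ab_group_add \<Rightarrow> 'a) \<Rightarrow> ('a \<Rightarrow> 'k) set" where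
  "dual s = {\<zeta>. Vector_Spaces.linear s (*) \<zeta>}"

definition dual_scale :: "'k::field \<Rightarrow> ('a \<Rightarrow> 'k) \<Rightarrow> 'a \<Rightarrow> 'k" where
  "dual_scale c \<zeta> = (\<lambda>x. c * \<zeta> x)"

type_synonym ('a, 'k) tensor2 = "('a \<Rightarrow> 'k) \<Rightarrow> ('a \<Rightarrow> 'k) \<Rightarrow> 'k"
type_synonym ('a, 'k) tensor3 = "('a \<Rightarrow> 'k) \<Rightarrow> ('a \<Rightarrow> 'k) \<Rightarrow> ('a \<Rightarrow> 'k) \<Rightarrow> 'k"

definition tens2 :: "('k::field \<Rightarrow> 'a::ab_group_add \<Rightarrow> 'a) \<Rightarrow> 'a \<Rightarrow> 'a \<Rightarrow> ('a, 'k) tensor2" where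
  "tens2 s x y = (\<lambda>\<zeta> \<eta>. if \<zeta> \<in> dual s \<and> \<eta> \<in> dual s then \<zeta> x * \<eta> y else 0)"

definition tens3 :: "('k::field \<Rightarrow> 'a::ab_group_add \<Rightarrow> 'a) \<Rightarrow> 'a \<Rightarrow> 'a \<Rightarrow> 'a \<Rightarrow> ('a, 'k) tensor3" where
  "tens3 s x y z =
     (\<lambda>\<zeta> \<eta> \<theta>. if \<zeta> \<in> dual s \<and> \<eta> \<in> dual s \<and> \<theta> \<in> dual s then \<zeta> x * \<eta> y * \<theta> z else 0)"

definition scale2 :: "'k::field \<Rightarrow> ('a, 'k) tensor2 \<Rightarrow> ('a, 'k) tensor2" where
  "scale2 c t = (\<lambda>\<zeta> \<eta>. c * t \<zeta> \<eta>)"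

definition scale3 :: "'k::field \<Rightarrow> ('a, 'k) tensor3 \<Rightarrow> ('a, 'k) tensor3" where
  "scale3 c t = (\<lambda>\<zeta> \<eta> \<theta>. c * t \<zeta> \<eta> \<theta>)"

definition tensor_square :: "('k::field \<Rightarrow> 'a::ab_group_add \<Rightarrow> 'a) \<Rightarrow> ('a, 'k) tensor2 set" where
  "tensor_square s = module.span scale2 {tens2 s x y |x y. True}"

definition tensor_cube :: "('k::field \<Rightarrow> 'a::ab_group_add \<Rightarrow> 'a) \<Rightarrow> ('a, 'k) tensor3 set" where
  "tensor_cube s = module.span scale3 {tens3 s x y z |x y z. True}"

text \<open>\<open>tswap\<close> is the flip \<open>\<tau>\<close>, and \<open>tmap s f g\<close> is \<open>f \<otimes> g\<close> for linear maps \<open>f\<close> and \<open>g\<close>;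
  see \<open>tswap_tens2\<close> and \<open>tmap_tens2\<close> for their values on pure tensors.\<close>

definition tswap :: "('a, 'k) tensor2 \<Rightarrow> ('a, 'k) tensor2" where
  "tswap t = (\<lambda>\<zeta> \<eta>. t \<eta> \<zeta>)"

definition tmap :: "('k::field \<Rightarrow> 'a::ab_group_add \<Rightarrow> 'a) \<Rightarrow> ('a \<Rightarrow> 'a) \<Rightarrow> ('a \<Rightarrow> 'a) \<Rightarrow>
    ('a, 'k) tensor2 \<Rightarrow> ('a, 'k) tensor2" where
  "tmap s f g t =
     (\<lambda>\<zeta> \<eta>. if \<zeta> \<in> dual s \<and> \<eta> \<in> dual s then t (\<lambda>x. \<zeta> (f x)) (\<lambda>y. \<eta> (g y)) else 0)"

lemma vector_space_times: "vector_space ((*) :: 'k::field \<Rightarrow> _)"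
  by unfold_locales (simp_all add: algebra_simps)

lemma vector_space_dual_scale: "vector_space (dual_scale :: 'k::field \<Rightarrow> ('a \<Rightarrow> 'k) \<Rightarrow> _)"
  by unfold_locales (auto simp: dual_scale_def fun_eq_iff algebra_simps)

lemma vector_space_scale2: "vector_space (scale2 :: 'k::field \<Rightarrow> ('a, 'k) tensor2 \<Rightarrow> _)"
  by unfold_locales (auto simp: scale2_def fun_eq_iff algebra_simps)

lemma vector_space_scale3: "vector_space (scale3 :: 'k::field \<Rightarrow> ('a, 'k) tensor3 \<Rightarrow> _)"
  by unfold_locales (auto simp: scale3_def fun_eq_iff algebra_simps)

lemma dual_add: "\<zeta> \<in> dual s \<Longrightarrow> \<zeta> (x + y) = \<zeta> x + \<zeta> y"
  and dual_cmult: "\<zeta> \<in> dual s \<Longrightarrow> \<zeta> (s c x) = c * \<zeta> x"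
  by (auto simp: dual_def Vector_Spaces.linear_iff)

lemma tswap_tens2: "tswap (tens2 s x y) = tens2 s y x"
  by (auto simp: tswap_def tens2_def fun_eq_iff)

lemma tmap_tens2:
  assumes "Vector_Spaces.linear s s f" and "Vector_Spaces.linear s s g"
  shows "tmap s f g (tens2 s x y) = tens2 s (f x) (g y)"
proof -
  have "(\<lambda>x. \<zeta> (f x)) \<in> dual s" "(\<lambda>x. \<zeta> (g x)) \<in> dual s" if "\<zeta> \<in> dual s" for \<zeta>
    using that assms by (simp_all add: dual_def Vector_Spaces.linear_iff)
  then show ?thesis
    by (auto simp: tmap_def tens2_def fun_eq_iff)
qed

lemma (in vector_space) independent_if_dual_family:
  assumes lin: "\<And>j. j \<in> J \<Longrightarrow> Vector_Spaces.linear scale (*) (\<phi> j)"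
    and dual: "\<And>i j. i \<in> J \<Longrightarrow> j \<in> J \<Longrightarrow> \<phi> j (u i) = (if i = j then 1 else 0)"
  shows "independent (u ` J)"
  unfolding dependent_explicit
proof clarify
  fix T c v assume T: "finite T" "T \<subseteq> u ` J" and 0: "(\<Sum>v\<in>T. scale (c v) v) = 0"
    and v: "v \<in> T" "c v \<noteq> 0"
  obtain j where j: "j \<in> J" "v = u j" using v T by blast
  interpret \<phi>: Vector_Spaces.linear scale "(*)" "\<phi> j" by (rule lin[OF j(1)])
  have eq: "\<phi> j w = (if w = v then 1 else 0)" if "w \<in> T" for w
    using that T(2) dual j by (smt (verit) imageE in_mono zero_neq_one)
  have "0 = (\<Sum>w\<in>T. c w * \<phi> j w)"
    using arg_cong[OF 0, of "\<phi> j"] by (simp add: \<phi>.sum \<phi>.scale \<phi>.zero)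
  also have "\<dots> = (\<Sum>w\<in>T. if w = v then c w else 0)"
    by (rule sum.cong) (auto simp: eq)
  also have "\<dots> = c v" using T(1) v(1) by simp
  finally show False using v by simp
qed

text \<open>
  Universal property: every multilinear map factors through the pure tensors, and a linear map on
  the tensor square (cube) is determined by its values on them.
\<close>

context vector_space
begin

lemma linear_tens2_left: "Vector_Spaces.linear scale scale2 (\<lambda>x. tens2 scale x y)"
  and linear_tens2_right: "Vector_Spaces.linear scale scale2 (\<lambda>x. tens2 scale y x)"
  unfolding Vector_Spaces.linear_iff
  by (auto simp: vector_space_axioms vector_space_scale2 tens2_def scale2_def fun_eq_iff
      dual_add dual_cmult algebra_simps)

lemma linear_tens3_1: "Vector_Spaces.linear scale scale3 (\<lambda>x. tens3 scale x y z)"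
  and linear_tens3_2: "Vector_Spaces.linear scale scale3 (\<lambda>x. tens3 scale y x z)"
  and linear_tens3_3: "Vector_Spaces.linear scale scale3 (\<lambda>x. tens3 scale y z x)"
  unfolding Vector_Spaces.linear_iff
  by (auto simp: vector_space_axioms vector_space_scale3 tens3_def scale3_def fun_eq_iff
      dual_add dual_cmult algebra_simps)

lemma obtain_basis_coordinates:
  obtains B \<epsilon> where "span B = UNIV" "\<And>b. \<epsilon> b \<in> dual scale"
    "\<And>b c. b \<in> B \<Longrightarrow> \<epsilon> c b = (if b = c then 1 else 0)"
proof -
  define B where "B = extend_basis {}"
  have B: "independent B" "span B = UNIV"
    by (simp_all add: B_def independent_extend_basis independent_empty span_extend_basis)
  show thesis
  proof (rule that[of B "\<lambda>b v. representation B v b"])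
    show "(\<lambda>v. representation B v b) \<in> dual scale" for b
      using B by (simp add: dual_def Vector_Spaces.linear_iff representation_add
          representation_scale vector_space_axioms vector_space_times)
    show "representation B b c = (if b = c then 1 else 0)" if "b \<in> B" for b c
      using that B by (simp add: representation_basis)
  qed (use B in simp)
qed

lemma tensor_square_universal:
  fixes scaleW :: "'a \<Rightarrow> 'w::ab_group_add \<Rightarrow> 'w"
  assumes l: "\<And>y. Vector_Spaces.linear scale scaleW (\<lambda>x. f x y)"
    and r: "\<And>x. Vector_Spaces.linear scale scaleW (\<lambda>y. f x y)"
  shows "\<exists>F. Vector_Spaces.linear scale2 scaleW F \<and> (\<forall>x y. F (tens2 scale x y) = f x y)"
proof -
  interpret W: vector_space scaleW using l Vector_Spaces.linear_iff by blast
  interpret T: vector_space "scale2 :: 'a \<Rightarrow> ('b, 'a) tensor2 \<Rightarrow> _" by (rule vector_space_scale2)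
  interpret TW: vector_space_pair "scale2 :: 'a \<Rightarrow> ('b, 'a) tensor2 \<Rightarrow> _" scaleW ..
  interpret VW: vector_space_pair scale scaleW ..
  obtain B \<epsilon> where B: "span B = UNIV" and \<epsilon>: "\<And>b. \<epsilon> b \<in> dual scale"
    and \<epsilon>B: "\<And>b c. b \<in> B \<Longrightarrow> \<epsilon> c b = (if b = c then 1 else 0)"
    by (metis obtain_basis_coordinates)
  define u :: "_ \<Rightarrow> ('b, 'a) tensor2" where "u = (\<lambda>(b, c). tens2 scale b c)"
  define \<phi> :: "_ \<Rightarrow> ('b, 'a) tensor2 \<Rightarrow> 'a" where "\<phi> = (\<lambda>(b, c) t. t (\<epsilon> b) (\<epsilon> c))"
  have \<phi>u: "\<phi> j (u i) = (if i = j then 1 else 0)" if "i \<in> B \<times> B" "j \<in> B \<times> B" for i j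
    using that by (auto simp: \<phi>_def u_def tens2_def \<epsilon> \<epsilon>B split: if_splits)
  have "T.independent (u ` (B \<times> B))"
  proof (rule T.independent_if_dual_family[where \<phi> = \<phi>])
    show "Vector_Spaces.linear scale2 (*) (\<phi> j)" for j
      by (simp add: Vector_Spaces.linear_iff T.vector_space_axioms \<phi>_def scale2_def
          vector_space_times split: prod.split)
  qed (rule \<phi>u)
  moreover have inj: "inj_on u (B \<times> B)"
    by (rule inj_onI) (metis \<phi>u zero_neq_one)
  ultimately obtain F where F: "Vector_Spaces.linear scale2 scaleW F"
      "\<And>t. t \<in> u ` (B \<times> B) \<Longrightarrow> F t = (case_prod f) (the_inv_into (B \<times> B) u t)"
    using TW.linear_independent_extend[of "u ` (B \<times> B)" "\<lambda>t. (case_prod f) (the_inv_into (B \<times> B) u t)"] by blast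
  have F0: "F (tens2 scale b c) = f b c" if "b \<in> B" "c \<in> B" for b c
    using F(2)[of "u (b, c)"] that by (simp add: the_inv_into_f_f[OF inj]) (simp add: u_def)
  note comp = Vector_Spaces.linear_compose[OF linear_tens2_left F(1), unfolded o_def]
    Vector_Spaces.linear_compose[OF linear_tens2_right F(1), unfolded o_def]
  have F1: "F (tens2 scale x c) = f x c" if "c \<in> B" for x c
    by (rule VW.linear_eq_on[OF comp(1) l, of _ B]) (simp_all add: B F0 that)
  have F2: "F (tens2 scale x y) = f x y" for x y
    by (rule VW.linear_eq_on[OF comp(2) r, of _ B]) (simp_all add: B F1)
  show ?thesis using F F2 by blast
qed

lemma tensor_cube_universal:
  fixes scaleW :: "'a \<Rightarrow> 'w::ab_group_add \<Rightarrow> 'w"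
  assumes 1: "\<And>y z. Vector_Spaces.linear scale scaleW (\<lambda>x. f x y z)"
    and 2: "\<And>x z. Vector_Spaces.linear scale scaleW (\<lambda>y. f x y z)"
    and 3: "\<And>x y. Vector_Spaces.linear scale scaleW (\<lambda>z. f x y z)"
  shows "\<exists>F. Vector_Spaces.linear scale3 scaleW F \<and> (\<forall>x y z. F (tens3 scale x y z) = f x y z)"
proof -
  interpret W: vector_space scaleW using 1 Vector_Spaces.linear_iff by blast
  interpret T: vector_space "scale3 :: 'a \<Rightarrow> ('b, 'a) tensor3 \<Rightarrow> _" by (rule vector_space_scale3)
  interpret TW: vector_space_pair "scale3 :: 'a \<Rightarrow> ('b, 'a) tensor3 \<Rightarrow> _" scaleW ..
  interpret VW: vector_space_pair scale scaleW ..
  obtain B \<epsilon> where B: "span B = UNIV" and \<epsilon>: "\<And>b. \<epsilon> b \<in> dual scale"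
    and \<epsilon>B: "\<And>b c. b \<in> B \<Longrightarrow> \<epsilon> c b = (if b = c then 1 else 0)"
    by (metis obtain_basis_coordinates)
  define u :: "_ \<Rightarrow> ('b, 'a) tensor3" where "u = (\<lambda>(b, c, d). tens3 scale b c d)"
  define \<phi> :: "_ \<Rightarrow> ('b, 'a) tensor3 \<Rightarrow> 'a" where "\<phi> = (\<lambda>(b, c, d) t. t (\<epsilon> b) (\<epsilon> c) (\<epsilon> d))"
  have \<phi>u: "\<phi> j (u i) = (if i = j then 1 else 0)" if "i \<in> B \<times> B \<times> B" "j \<in> B \<times> B \<times> B" for i j
    using that by (auto simp: \<phi>_def u_def tens3_def \<epsilon> \<epsilon>B split: if_splits)
  have "T.independent (u ` (B \<times> B \<times> B))"
  proof (rule T.independent_if_dual_family[where \<phi> = \<phi>])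
    show "Vector_Spaces.linear scale3 (*) (\<phi> j)" for j
      by (simp add: Vector_Spaces.linear_iff T.vector_space_axioms \<phi>_def scale3_def
          vector_space_times split: prod.split)
  qed (rule \<phi>u)
  moreover have inj: "inj_on u (B \<times> B \<times> B)"
    by (rule inj_onI) (metis \<phi>u zero_neq_one)
  ultimately obtain F where F: "Vector_Spaces.linear scale3 scaleW F"
      "\<And>t. t \<in> u ` (B \<times> B \<times> B) \<Longrightarrow>
        F t = (\<lambda>(b, c, d). f b c d) (the_inv_into (B \<times> B \<times> B) u t)"
    using TW.linear_independent_extend[of "u ` (B \<times> B \<times> B)" "\<lambda>t. (\<lambda>(b, c, d). f b c d) (the_inv_into (B \<times> B \<times> B) u t)"] by blast
  have F0: "F (tens3 scale b c d) = f b c d" if "b \<in> B" "c \<in> B" "d \<in> B" for b c d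
    using F(2)[of "u (b, c, d)"] that
    by (simp add: the_inv_into_f_f[OF inj]) (simp add: u_def)
  note comp = Vector_Spaces.linear_compose[OF linear_tens3_1 F(1), unfolded o_def]
    Vector_Spaces.linear_compose[OF linear_tens3_2 F(1), unfolded o_def]
    Vector_Spaces.linear_compose[OF linear_tens3_3 F(1), unfolded o_def]
  have F1: "F (tens3 scale x c d) = f x c d" if "c \<in> B" "d \<in> B" for x c d
    by (rule VW.linear_eq_on[OF comp(1) 1, of _ B]) (simp_all add: B F0 that)
  have F2: "F (tens3 scale x y d) = f x y d" if "d \<in> B" for x y d
    by (rule VW.linear_eq_on[OF comp(2) 2, of _ B]) (simp_all add: B F1 that)
  have F3: "F (tens3 scale x y z) = f x y z" for x y z
    by (rule VW.linear_eq_on[OF comp(3) 3, of _ B]) (simp_all add: B F2)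
  show ?thesis using F F3 by blast
qed

lemma tensor_square_unique:
  assumes "Vector_Spaces.linear scale2 scaleW F" "Vector_Spaces.linear scale2 scaleW G"
    and "\<And>x y. F (tens2 scale x y) = G (tens2 scale x y)" and "t \<in> tensor_square scale"
  shows "F t = G t"
proof -
  interpret vector_space_pair "scale2 :: 'a \<Rightarrow> ('b, 'a) tensor2 \<Rightarrow> _" scaleW
    using assms(1) by (simp add: vector_space_pair_def Vector_Spaces.linear_iff)
  show ?thesis
    by (rule linear_eq_on[OF assms(1,2) assms(4)[unfolded tensor_square_def]]) (auto simp: assms(3))
qed

lemma tensor_cube_unique:
  assumes "Vector_Spaces.linear scale3 scaleW F" "Vector_Spaces.linear scale3 scaleW G"
    and "\<And>x y z. F (tens3 scale x y z) = G (tens3 scale x y z)" and "t \<in> tensor_cube scale"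
  shows "F t = G t"
proof -
  interpret vector_space_pair "scale3 :: 'a \<Rightarrow> ('b, 'a) tensor3 \<Rightarrow> _" scaleW
    using assms(1) by (simp add: vector_space_pair_def Vector_Spaces.linear_iff)
  show ?thesis
    by (rule linear_eq_on[OF assms(1,2) assms(4)[unfolded tensor_cube_def]]) (auto simp: assms(3))
qed

end


section \<open>Anti-pre-Poisson algebras\<close>

text \<open>The carrier is a subspace \<open>V\<close> of a type, so that the definitions apply to \<open>A\<close> (with
  \<open>V = UNIV\<close>) as well as to its dual space.\<close>

locale bilinear_algebra = vector_space s
  for s :: "'k::field \<Rightarrow> 'v::ab_group_add \<Rightarrow> 'v" +
  fixes V :: "'v set" and mul :: "'v \<Rightarrow> 'v \<Rightarrow> 'v"
  assumes subspace_V: "subspace V"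
    and closed: "\<lbrakk>x \<in> V; y \<in> V\<rbrakk> \<Longrightarrow> mul x y \<in> V"
    and add_left: "\<lbrakk>x \<in> V; y \<in> V; z \<in> V\<rbrakk> \<Longrightarrow> mul (x + y) z = mul x z + mul y z"
    and add_right: "\<lbrakk>x \<in> V; y \<in> V; z \<in> V\<rbrakk> \<Longrightarrow> mul x (y + z) = mul x y + mul x z"
    and scale_left: "\<lbrakk>x \<in> V; y \<in> V\<rbrakk> \<Longrightarrow> mul (s c x) y = s c (mul x y)"
    and scale_right: "\<lbrakk>x \<in> V; y \<in> V\<rbrakk> \<Longrightarrow> mul x (s c y) = s c (mul x y)"

locale anti_Zinbiel_algebra = bilinear_algebra s V zin
  for s :: "'k::field \<Rightarrow> 'v::ab_group_add \<Rightarrow> 'v" and V and zin (infixl "\<^bold>*" 70) +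
  assumes zin1: "\<lbrakk>x \<in> V; y \<in> V; z \<in> V\<rbrakk> \<Longrightarrow>
      x \<^bold>* (y \<^bold>* z) = - ((x \<^bold>* y + y \<^bold>* x) \<^bold>* z)"
    and zin2: "\<lbrakk>x \<in> V; y \<in> V; z \<in> V\<rbrakk> \<Longrightarrow>
      - ((x \<^bold>* y + y \<^bold>* x) \<^bold>* z) = - ((z \<^bold>* y + y \<^bold>* z) \<^bold>* x)"
    and zin3: "\<lbrakk>x \<in> V; y \<in> V; z \<in> V\<rbrakk> \<Longrightarrow>
      - ((z \<^bold>* y + y \<^bold>* z) \<^bold>* x) = z \<^bold>* (y \<^bold>* x)"
    and zin4: "\<lbrakk>x \<in> V; y \<in> V; z \<in> V\<rbrakk> \<Longrightarrow> z \<^bold>* (x \<^bold>* y) = x \<^bold>* (z \<^bold>* y)"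

definition star :: "('v \<Rightarrow> 'v \<Rightarrow> 'v) \<Rightarrow> 'v \<Rightarrow> 'v \<Rightarrow> 'v::ab_group_add" where
  "star zin x y = zin x y + zin y x"

definition bracket :: "('v \<Rightarrow> 'v \<Rightarrow> 'v) \<Rightarrow> 'v \<Rightarrow> 'v \<Rightarrow> 'v::ab_group_add" where
  "bracket circ x y = circ x y - circ y x"

locale anti_pre_Lie_algebra = bilinear_algebra s V circ
  for s :: "'k::field \<Rightarrow> 'v::ab_group_add \<Rightarrow> 'v" and V and circ (infixl "\<odot>" 70) +
  assumes apl1: "\<lbrakk>x \<in> V; y \<in> V; z \<in> V\<rbrakk> \<Longrightarrow>
      x \<odot> (y \<odot> z) - y \<odot> (x \<odot> z) = bracket circ y x \<odot> z"
    and apl2: "\<lbrakk>x \<in> V; y \<in> V; z \<in> V\<rbrakk> \<Longrightarrow>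
      bracket circ x y \<odot> z + bracket circ y z \<odot> x + bracket circ z x \<odot> y = 0"

locale anti_pre_Poisson_algebra =
  zin: anti_Zinbiel_algebra s V zin + circ: anti_pre_Lie_algebra s V circ
  for s :: "'k::field \<Rightarrow> 'v::ab_group_add \<Rightarrow> 'v" and V
    and zin (infixl "\<^bold>*" 70) and circ (infixl "\<odot>" 70) +
  assumes app1: "\<lbrakk>x \<in> V; y \<in> V; z \<in> V\<rbrakk> \<Longrightarrow>
      (x \<odot> y - y \<odot> x) \<^bold>* z = y \<^bold>* (x \<odot> z) - x \<odot> (y \<^bold>* z)"
    and app2: "\<lbrakk>x \<in> V; y \<in> V; z \<in> V\<rbrakk> \<Longrightarrow>
      (x \<^bold>* y + y \<^bold>* x) \<odot> z = - (x \<^bold>* (y \<odot> z)) - y \<^bold>* (x \<odot> z)"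
    and app3: "\<lbrakk>x \<in> V; y \<in> V; z \<in> V\<rbrakk> \<Longrightarrow>
      z \<odot> (x \<^bold>* y + y \<^bold>* x) + x \<^bold>* (y \<odot> z) + y \<^bold>* (x \<odot> z)
        = x \<^bold>* (z \<odot> y) + y \<^bold>* (z \<odot> x)"


section \<open>Coalgebras and bialgebras\<close>

definition dual_op :: "('a \<Rightarrow> ('a, 'k) tensor2) \<Rightarrow> ('a \<Rightarrow> 'k) \<Rightarrow> ('a \<Rightarrow> 'k) \<Rightarrow> 'a \<Rightarrow> 'k" where
  "dual_op \<Delta> \<zeta> \<eta> = (\<lambda>x. \<Delta> x \<zeta> \<eta>)"

locale anti_pre_Poisson_coalgebra =
  fixes s :: "'k::field \<Rightarrow> 'a::ab_group_add \<Rightarrow> 'a" and \<Delta> \<delta> :: "'a \<Rightarrow> ('a, 'k) tensor2"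
  assumes linear_\<Delta>: "Vector_Spaces.linear s scale2 \<Delta>"
    and linear_\<delta>: "Vector_Spaces.linear s scale2 \<delta>"
    and range_\<Delta>: "\<Delta> x \<in> tensor_square s"
    and range_\<delta>: "\<delta> x \<in> tensor_square s"
    and dual_algebra: "anti_pre_Poisson_algebra dual_scale (dual s) (dual_op \<Delta>) (dual_op \<delta>)"

text \<open>In the axioms below \<open>zin x\<close> is \<open>L\<^sub>*(x)\<close>, \<open>\<lambda>z. zin z y\<close> is \<open>R\<^sub>*(y)\<close>, \<open>star zin x\<close> is
  \<open>L\<^sub>\<star>(x)\<close>, and \<open>bracket circ x\<close> is \<open>ad(x)\<close>.\<close>

locale anti_pre_Poisson_bialgebra =
  anti_pre_Poisson_algebra s UNIV zin circ + anti_pre_Poisson_coalgebra s \<Delta> \<delta>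
  for s :: "'k::field \<Rightarrow> 'a::ab_group_add \<Rightarrow> 'a" and zin circ :: "'a \<Rightarrow> 'a \<Rightarrow> 'a"
    and \<Delta> \<delta> :: "'a \<Rightarrow> ('a, 'k) tensor2" +
  assumes bialg1: "\<Delta> (star zin x y) = tmap s id (star zin x) (\<Delta> y) - tmap s (zin y) id (\<Delta> x)"
    and bialg2: "\<Delta> (zin x y) + tswap (\<Delta> (zin x y))
      = tmap s (zin x) id (\<Delta> y + tswap (\<Delta> y)) - tmap s id (\<lambda>z. zin z y) (\<Delta> x)"
    and bialg3: "\<delta> (bracket circ x y)
      = (tmap s id (bracket circ x) (\<delta> y) - tmap s (circ x) id (\<delta> y))
        - (tmap s id (bracket circ y) (\<delta> x) - tmap s (circ y) id (\<delta> x))"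
    and bialg4: "let t = \<delta> (circ x y) - tmap s (circ x) id (\<delta> y) - tmap s id (circ x) (\<delta> y)
                         + tmap s id (\<lambda>z. circ z y) (\<delta> x)
      in t - tswap t = 0"
    and bialg5: "\<delta> (star zin x y)
      = tmap s id (star zin x) (\<delta> y) + tmap s id (star zin y) (\<delta> x)
        + tmap s (circ x) id (\<Delta> y) + tmap s (circ y) id (\<Delta> x)"
    and bialg6: "\<Delta> (bracket circ x y)
      = - tmap s (circ x) id (\<Delta> y) - tmap s id (star zin y) (\<delta> x)
        - tmap s (zin y) id (\<delta> x) + tmap s id (bracket circ x) (\<Delta> y)"
    and bialg7: "\<Delta> (circ x y) + tswap (\<Delta> (circ x y))
      = (let t = tmap s (circ x) id (\<Delta> y) + tmap s id (circ x) (\<Delta> y)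
                 + tmap s id (\<lambda>z. zin z y) (\<delta> x)
         in t + tswap t)"
    and bialg8: "\<delta> (zin x y) - tswap (\<delta> (zin x y))
      = tmap s id (zin x) (\<delta> y) - tswap (tmap s (zin x) id (\<delta> y))
        - tmap s (circ x) id (\<Delta> y) - tswap (tmap s id (circ x) (\<Delta> y))
        - tmap s id (\<lambda>z. zin z y) (\<delta> x) - tswap (tmap s id (\<lambda>z. circ z y) (\<Delta> x))"


section \<open>Yang--Baxter expressions and the coboundary comultiplications\<close>

text \<open>\<open>YB_D\<close> and \<open>YB_S\<close> take a decomposition \<open>r = (\<Sum>i\<in>I. a i \<otimes> b i)\<close>, as in the formulas for
  \<open>D(r)\<close> and \<open>S(r)\<close>.\<close>

definition YB_D :: "('k::field \<Rightarrow> 'a::ab_group_add \<Rightarrow> 'a) \<Rightarrow> ('a \<Rightarrow> 'a \<Rightarrow> 'a) \<Rightarrow>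
    'i set \<Rightarrow> ('i \<Rightarrow> 'a) \<Rightarrow> ('i \<Rightarrow> 'a) \<Rightarrow> ('a, 'k) tensor3" where
  "YB_D s zin I a b = (\<Sum>i\<in>I. \<Sum>j\<in>I.
      tens3 s (a i) (zin (b i) (a j)) (b j) - tens3 s (zin (a i) (a j)) (b i) (b j)
      + tens3 s (a i) (a j) (star zin (b i) (b j)))"

definition YB_S :: "('k::field \<Rightarrow> 'a::ab_group_add \<Rightarrow> 'a) \<Rightarrow> ('a \<Rightarrow> 'a \<Rightarrow> 'a) \<Rightarrow>
    'i set \<Rightarrow> ('i \<Rightarrow> 'a) \<Rightarrow> ('i \<Rightarrow> 'a) \<Rightarrow> ('a, 'k) tensor3" where
  "YB_S s circ I a b = (\<Sum>i\<in>I. \<Sum>j\<in>I.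
      tens3 s (circ (a i) (a j)) (b i) (b j) + tens3 s (a i) (circ (b i) (a j)) (b j)
      - tens3 s (a i) (a j) (bracket circ (b i) (b j)))"

definition Delta_r :: "('k::field \<Rightarrow> 'a::ab_group_add \<Rightarrow> 'a) \<Rightarrow> ('a \<Rightarrow> 'a \<Rightarrow> 'a) \<Rightarrow>
    ('a, 'k) tensor2 \<Rightarrow> 'a \<Rightarrow> ('a, 'k) tensor2" where
  "Delta_r s zin r x = - (tmap s id (star zin x) r + tmap s (zin x) id r)"

definition delta_r :: "('k::field \<Rightarrow> 'a::ab_group_add \<Rightarrow> 'a) \<Rightarrow> ('a \<Rightarrow> 'a \<Rightarrow> 'a) \<Rightarrow>
    ('a, 'k) tensor2 \<Rightarrow> 'a \<Rightarrow> ('a, 'k) tensor2" where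
  "delta_r s circ r x = tmap s (circ x) id r - tmap s id (bracket circ x) r"

end

theory Submission
  imports Defs
begin

text \<open>
  A tensor \<open>r = (\<Sum>i. a i \<otimes> b i)\<close> is the same thing as the linear map \<open>sharp : A\<^sup>* \<rightarrow> A\<close>,
  \<open>\<zeta> \<mapsto> (\<Sum>i. \<zeta>(a i) b i)\<close>, and \<open>r\<close> is skew-symmetric iff \<open>\<langle>sharp \<zeta>, \<eta>\<rangle> = - \<langle>\<zeta>, sharp \<eta>\<rangle>\<close>.
  In these terms the operations on \<open>A\<^sup>*\<close> dual to the coboundary comultiplications are
  \<open>\<zeta> \<ast> \<eta> = R\<^sub>*\<^sup>t(sharp \<eta>) \<zeta> - L\<^sub>\<star>\<^sup>t(sharp \<zeta>) \<eta>\<close> and \<open>\<zeta> \<circ> \<eta> = ad\<^sup>t(sharp \<zeta>) \<eta> - R\<^sub>\<circ>\<^sup>t(sharp \<eta>) \<zeta>\<close>,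
  where \<open>F\<^sup>t\<close> is the transpose \<open>\<zeta> \<mapsto> \<zeta> \<circ> F\<close> (\<open>dual_op_Delta\<close>, \<open>dual_op_delta\<close>). Pairing \<open>D(r)\<close> and
  \<open>S(r)\<close> with three functionals and moving every \<open>sharp\<close> to the same side by skew-symmetry shows
  that \<open>D(r) = 0\<close> and \<open>S(r) = 0\<close> say that \<open>sharp\<close> is multiplicative for both operations
  (\<open>sharp_dual_op_Delta\<close>, \<open>sharp_dual_op_delta\<close>).

  Given multiplicativity, an axiom for \<open>A\<^sup>*\<close>, paired with \<open>x \<in> A\<close>, becomes a sum of three terms:
  each of \<open>\<zeta>\<close>, \<open>\<eta>\<close>, \<open>\<theta>\<close> is applied to an expression of degree three in \<open>x\<close> and the images under
  \<open>sharp\<close> of the other two. Each of these three expressions vanishes by the axioms of \<open>A\<close>; in other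
  words, \<open>A\<^sup>*\<close> is a representation of \<open>A\<close> by the transposes \<open>-L\<^sub>\<star>\<^sup>t\<close>, \<open>R\<^sub>*\<^sup>t\<close>, \<open>ad\<^sup>t\<close>, \<open>-R\<^sub>\<circ>\<^sup>t\<close> and
  \<open>sharp\<close> is a relative Rota-Baxter operator for it.

  The eight compatibility conditions come from skew-symmetry and the axioms of \<open>A\<close>. Paired with
  \<open>\<zeta> \<otimes> \<eta>\<close>, such a condition contains expressions of degree three in \<open>x\<close>, \<open>y\<close> and one of \<open>sharp \<zeta>\<close>,
  \<open>sharp \<eta>\<close>, which again cancel by the axioms of \<open>A\<close>, and terms in which \<open>r\<close> is hit by one
  multiplication operator on each leg, which cancel once skew-symmetry has brought them to a common
  form (\<open>sharp_mixed\<close>).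

  Hence the whole proof rests on the identities of degree three in \<open>A\<close>. For three given elements
  they are all decided by the reduction rules \<open>degree_three\<close>, whose coefficients are \<open>1\<close> and \<open>-1\<close>,
  so that they serve in every characteristic.
\<close>

section \<open>Degree three identities in an anti-pre-Poisson algebra\<close>

text \<open>Linear consequences of identities in an abelian group: the second premise is an identity of the
  group, to be settled by normalisation.\<close>

lemma eq_by_differences:
  fixes l :: "'a::ab_group_add"
  assumes "p = q" and "l - m = p - q"
  shows "l = m"
  using assms by simp

context bilinear_algebra
begin

lemma mul_sum_left:
  assumes u: "\<And>i. u i \<in> V" and y: "y \<in> V"
  shows "mul (\<Sum>i\<in>I. s (p i) (u i)) y = (\<Sum>i\<in>I. s (p i) (mul (u i) y))"
proof -
  have 0: "mul 0 y = 0" using scale_left[OF y y, of 0] by simp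
  show ?thesis
    by (induction I rule: infinite_finite_induct)
      (simp_all add: 0 u y add_left scale_left subspace_V subspace_scale subspace_sum)
qed

lemma mul_sum_right:
  assumes v: "\<And>j. v j \<in> V" and x: "x \<in> V"
  shows "mul x (\<Sum>j\<in>J. s (q j) (v j)) = (\<Sum>j\<in>J. s (q j) (mul x (v j)))"
proof -
  have 0: "mul x 0 = 0" using scale_right[OF x x, of 0] by simp
  show ?thesis
    by (induction J rule: infinite_finite_induct)
      (simp_all add: 0 v x add_right scale_right subspace_V subspace_scale subspace_sum)
qed

lemma mul_sum:
  assumes u: "\<And>i. u i \<in> V" and v: "\<And>j. v j \<in> V"
  shows "mul (\<Sum>i\<in>I. s (p i) (u i)) (\<Sum>j\<in>J. s (q j) (v j))
    = (\<Sum>i\<in>I. \<Sum>j\<in>J. s (p i * q j) (mul (u i) (v j)))"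
proof -
  have "(\<Sum>j\<in>J. s (q j) (v j)) \<in> V"
    by (simp add: v subspace_V subspace_scale subspace_sum)
  then show ?thesis
    by (simp add: mul_sum_left mul_sum_right u v scale_sum_right)
qed

end

lemma (in anti_Zinbiel_algebra) zin_reverse:
  assumes "x \<in> V" "y \<in> V" "z \<in> V"
  shows "x \<^bold>* (y \<^bold>* z) = z \<^bold>* (y \<^bold>* x)"
  using zin1[of x y z] zin2[of x y z] zin3[of x y z] assms by simp

locale anti_pre_Poisson_UNIV = anti_pre_Poisson_algebra s UNIV zin circ
  for s :: "'k::field \<Rightarrow> 'a::ab_group_add \<Rightarrow> 'a"
    and zin (infixl "\<^bold>*" 70) and circ (infixl "\<odot>" 70)
begin

lemma zin_add [simp]: "(x + y) \<^bold>* z = x \<^bold>* z + y \<^bold>* z" "x \<^bold>* (y + z) = x \<^bold>* y + x \<^bold>* z"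
  and zin_scale [simp]: "s c x \<^bold>* y = s c (x \<^bold>* y)" "x \<^bold>* s c y = s c (x \<^bold>* y)"
  and circ_add [simp]: "(x + y) \<odot> z = x \<odot> z + y \<odot> z" "x \<odot> (y + z) = x \<odot> y + x \<odot> z"
  and circ_scale [simp]: "s c x \<odot> y = s c (x \<odot> y)" "x \<odot> s c y = s c (x \<odot> y)"
  by (simp_all add: zin.add_left zin.add_right zin.scale_left zin.scale_right
      circ.add_left circ.add_right circ.scale_left circ.scale_right)

lemma zin_minus [simp]: "(- x) \<^bold>* z = - (x \<^bold>* z)" "x \<^bold>* (- z) = - (x \<^bold>* z)"
  and circ_minus [simp]: "(- x) \<odot> z = - (x \<odot> z)" "x \<odot> (- z) = - (x \<odot> z)"
  using zin_scale[where c = "- 1::'k"] circ_scale[where c = "- 1::'k"]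
  by (simp_all add: zin.scale_minus_left)

lemma zin_diff [simp]: "(x - y) \<^bold>* z = x \<^bold>* z - y \<^bold>* z" "x \<^bold>* (y - z) = x \<^bold>* y - x \<^bold>* z"
  and circ_diff [simp]: "(x - y) \<odot> z = x \<odot> z - y \<odot> z" "x \<odot> (y - z) = x \<odot> y - x \<odot> z"
  by (simp_all only: diff_conv_add_uminus zin_add circ_add zin_minus circ_minus)

text \<open>The left-nested products: the axioms determine their symmetric or antisymmetric part in the
  first two factors, so one of each pair can be exchanged for the other.\<close>

lemma zin_zin_left: "(x \<^bold>* y) \<^bold>* z = - (x \<^bold>* (y \<^bold>* z)) - (y \<^bold>* x) \<^bold>* z"
  by (rule eq_by_differences[OF zin.zin1[of x y z]]) (simp_all add: algebra_simps)

lemma circ_zin_left: "(x \<odot> y) \<^bold>* z = (y \<odot> x) \<^bold>* z + y \<^bold>* (x \<odot> z) - x \<odot> (y \<^bold>* z)"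
  by (rule eq_by_differences[OF app1[of x y z]]) (simp_all add: algebra_simps)

lemma zin_circ_left: "(x \<^bold>* y) \<odot> z = - ((y \<^bold>* x) \<odot> z) - x \<^bold>* (y \<odot> z) - y \<^bold>* (x \<odot> z)"
  by (rule eq_by_differences[OF app2[of x y z]]) (simp_all add: algebra_simps)

lemma circ_circ_left: "(x \<odot> y) \<odot> z = (y \<odot> x) \<odot> z + y \<odot> (x \<odot> z) - x \<odot> (y \<odot> z)"
  by (rule eq_by_differences[OF circ.apl1[of x y z]]) (simp_all add: bracket_def algebra_simps)

text \<open>Relations between right-nested products alone. The axiom for \<open>(x \<circ> y - y \<circ> x) \<ast> z\<close> has a left side
  that is antisymmetric in \<open>x\<close> and \<open>y\<close>, so its right side is antisymmetric as well.\<close>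

lemma zin_circ_exchange:
  "x \<^bold>* (y \<odot> z) = - (y \<^bold>* (x \<odot> z)) + x \<odot> (y \<^bold>* z) + y \<odot> (x \<^bold>* z)"
  by (rule eq_by_differences[OF arg_cong2[OF app1[of x y z] app1[of y x z], of "(+)", symmetric]])
    (simp_all add: algebra_simps)

text \<open>In the cyclic sum of the last axiom the products \<open>x \<ast> (y \<circ> z)\<close> occur in all six orders on either
  side and cancel. What remains is that the cyclic sum of \<open>x \<circ> (y \<star> z)\<close> vanishes.\<close>

lemma circ_star_cyclic:
  "x \<odot> (y \<^bold>* z) = - (x \<odot> (z \<^bold>* y)) - y \<odot> (z \<^bold>* x) - y \<odot> (x \<^bold>* z)
     - z \<odot> (x \<^bold>* y) - z \<odot> (y \<^bold>* x)"
  by (rule eq_by_differences[OF arg_cong2[OF app3[of x y z]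
        arg_cong2[OF app3[of y z x] app3[of z x y], of "(+)"], of "(+)"]])
    (simp_all add: algebra_simps)

text \<open>The last axiom with \<open>x \<ast> (z \<circ> y) + z \<ast> (x \<circ> y)\<close> rewritten by the exchange rule and
  \<open>y \<circ> (x \<star> z)\<close> by the cyclic relation. Together with the exchange rule this connects all six orders
  of \<open>x \<ast> (y \<circ> z)\<close>: each differs from the next, up to sign, by products of the form \<open>x \<circ> (y \<ast> z)\<close>.\<close>

lemma zin_circ_flip:
  "x \<^bold>* (y \<odot> z) = - (z \<^bold>* (y \<odot> x)) - x \<odot> (y \<^bold>* z) - z \<odot> (y \<^bold>* x)"
  by (rule eq_by_differences[OF arg_cong2[OF app3[of x z y, symmetric]
        arg_cong2[OF zin_circ_exchange[of x z y] circ_star_cyclic[of x y z], of "(+)"], of "(+)"]])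
    (simp_all add: algebra_simps)

text \<open>The cyclic axiom of an anti-pre-Lie algebra with each \<open>[x, y] \<circ> z\<close> replaced by right-nested
  products.\<close>

lemma circ_circ_cyclic:
  "x \<odot> (y \<odot> z) = y \<odot> (x \<odot> z) + z \<odot> (y \<odot> x) - y \<odot> (z \<odot> x) + x \<odot> (z \<odot> y) - z \<odot> (x \<odot> y)"
proof -
  have "(y \<odot> (x \<odot> z) - x \<odot> (y \<odot> z)) + (z \<odot> (y \<odot> x) - y \<odot> (z \<odot> x))
      + (x \<odot> (z \<odot> y) - z \<odot> (x \<odot> y)) = 0"
    using circ.apl2[of x y z] circ.apl1[of y x z] circ.apl1[of z y x] circ.apl1[of x z y]
    by simp
  from eq_by_differences[OF this[symmetric]] show ?thesis
    by (simp add: algebra_simps)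
qed

text \<open>
  For fixed \<open>x\<close>, \<open>y\<close>, \<open>z\<close> there are 48 multilinear products of degree three. The 24 instances below are
  oriented so that rewriting with them terminates: they eliminate one left-nested product of each
  pair, all orders of \<open>x \<ast> (y \<ast> z)\<close> except \<open>z \<ast> (y \<ast> x)\<close>, all orders of \<open>x \<ast> (y \<circ> z)\<close> except
  \<open>z \<ast> (y \<circ> x)\<close>, and one order each of \<open>x \<circ> (y \<ast> z)\<close> and \<open>x \<circ> (y \<circ> z)\<close>. The axioms have rank 24, so the
  remaining 24 products are a basis of the degree three part of the free algebra, and an identity
  follows from the axioms iff both sides reduce to the same combination. The rules are only ever
  used for given elements: with variables for \<open>x\<close>, \<open>y\<close>, \<open>z\<close> they would loop.
\<close>

lemmas degree_three =
  zin_zin_left[of x y z] zin_zin_left[of x z y] zin_zin_left[of y z x]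
  circ_zin_left[of x y z] circ_zin_left[of x z y] circ_zin_left[of y z x]
  zin_circ_left[of x y z] zin_circ_left[of x z y] zin_circ_left[of y z x]
  circ_circ_left[of x y z] circ_circ_left[of x z y] circ_circ_left[of y z x]
  zin.zin_reverse[of x y z, simplified] zin.zin_reverse[of x z y, simplified]
  zin.zin_reverse[of y x z, simplified] zin.zin4[of z x y, simplified]
  zin.zin4[of x y z, simplified]
  zin_circ_exchange[of y z x] zin_circ_flip[of x y z] zin_circ_flip[of x z y]
  zin_circ_exchange[of y x z] zin_circ_flip[of z x y]
  circ_star_cyclic[of x y z] circ_circ_cyclic[of x y z]
  for x y z

end

section \<open>A skew-symmetric tensor as an operator from the dual space\<close>

context vector_space
begin

lemma dual_linear:
  assumes "\<zeta> \<in> dual scale"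
  shows "\<zeta> (x + y) = \<zeta> x + \<zeta> y" "\<zeta> (scale c x) = c * \<zeta> x"
    "\<zeta> 0 = 0" "\<zeta> (- x) = - \<zeta> x" "\<zeta> (x - y) = \<zeta> x - \<zeta> y"
proof -
  interpret Vector_Spaces.linear scale "(*)" \<zeta>
    using assms by (simp add: dual_def)
  show "\<zeta> (x + y) = \<zeta> x + \<zeta> y" "\<zeta> (scale c x) = c * \<zeta> x"
    "\<zeta> 0 = 0" "\<zeta> (- x) = - \<zeta> x" "\<zeta> (x - y) = \<zeta> x - \<zeta> y"
    by (fact add scale zero neg diff)+
qed

lemma dual_sum:
  assumes "\<zeta> \<in> dual scale"
  shows "\<zeta> (\<Sum>i\<in>I. f i) = (\<Sum>i\<in>I. \<zeta> (f i))"
  by (induction I rule: infinite_finite_induct) (simp_all add: dual_linear[OF assms])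

lemma in_dualI:
  assumes "\<And>x y. \<zeta> (x + y) = \<zeta> x + \<zeta> y" and "\<And>c x. \<zeta> (scale c x) = c * \<zeta> x"
  shows "\<zeta> \<in> dual scale"
  using assms by (simp add: dual_def Vector_Spaces.linear_iff vector_space_axioms vector_space_times)

lemma dual_scale_apply: "dual_scale c \<zeta> x = c * \<zeta> x"
  by (simp add: dual_scale_def)

lemma dual_closed:
  assumes "\<zeta> \<in> dual scale" "\<eta> \<in> dual scale"
  shows "(\<lambda>x. \<zeta> x + \<eta> x) \<in> dual scale" "(\<lambda>x. \<zeta> x - \<eta> x) \<in> dual scale"
    "\<zeta> + \<eta> \<in> dual scale" "\<zeta> - \<eta> \<in> dual scale"
  by (rule in_dualI; simp add: dual_linear[OF assms(1)] dual_linear[OF assms(2)] algebra_simps)+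

lemma dual_scale_closed: "\<zeta> \<in> dual scale \<Longrightarrow> dual_scale c \<zeta> \<in> dual scale"
  by (rule in_dualI) (simp_all add: dual_linear dual_scale_def algebra_simps)

lemma dual_separates:
  assumes "\<And>\<zeta>. \<zeta> \<in> dual scale \<Longrightarrow> \<zeta> x = \<zeta> y"
  shows "x = y"
proof -
  define B where "B = extend_basis {}"
  have B: "independent B" "span B = UNIV"
    by (simp_all add: B_def independent_extend_basis independent_empty span_extend_basis)
  have "(\<lambda>v. representation B v c) \<in> dual scale" for c
    using B by (intro in_dualI) (simp_all add: representation_add representation_scale)
  then have "representation B x = representation B y"
    using assms by (auto simp: fun_eq_iff)
  moreover have "v = (\<Sum>c | representation B v c \<noteq> 0. scale (representation B v c) c)" for v
    using sum_nonzero_representation_eq[of B v] B by simp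
  ultimately show ?thesis by metis
qed

lemma subspace_dual: "module.subspace dual_scale (dual scale)"
  unfolding module.subspace_def[OF vector_space_dual_scale[folded module_iff_vector_space]]
  by (intro conjI ballI allI in_dualI) (simp_all add: dual_linear dual_scale_def algebra_simps)

end

lemma sum_fun_apply: "(\<Sum>i\<in>I. f i) x = (\<Sum>i\<in>I. f i x)"
  by (induction I rule: infinite_finite_induct) simp_all

locale skew_tensor = vector_space s
  for s :: "'k::field \<Rightarrow> 'a::ab_group_add \<Rightarrow> 'a" +
  fixes I :: "'i set" and a b :: "'i \<Rightarrow> 'a" and r :: "('a, 'k) tensor2"
  assumes r_eq: "r = (\<Sum>i\<in>I. tens2 s (a i) (b i))"
    and skew: "tswap r = - r"
begin

text \<open>The map \<open>r\<^sup>\<sharp>\<close>, characterised by \<open>\<langle>r\<^sup>\<sharp>(\<zeta>), \<eta>\<rangle> = \<langle>r, \<zeta> \<otimes> \<eta>\<rangle>\<close>; see \<open>r_eval\<close>.\<close>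

definition sharp :: "('a \<Rightarrow> 'k) \<Rightarrow> 'a" where
  "sharp \<zeta> = (\<Sum>i\<in>I. s (\<zeta> (a i)) (b i))"

lemma r_eval:
  assumes "\<zeta> \<in> dual s" "\<eta> \<in> dual s"
  shows "r \<zeta> \<eta> = \<eta> (sharp \<zeta>)"
  unfolding r_eq sharp_def dual_sum[OF assms(2)]
  by (induction I rule: infinite_finite_induct) (simp_all add: tens2_def assms dual_linear[OF assms(2)])

lemma skew_sharp: "\<zeta> \<in> dual s \<Longrightarrow> \<eta> \<in> dual s \<Longrightarrow> \<eta> (sharp \<zeta>) = - \<zeta> (sharp \<eta>)"
  using fun_cong[OF fun_cong[OF skew], of \<eta> \<zeta>] by (simp add: tswap_def r_eval)

lemma tmap_r_in_tensor_square:
  assumes "Vector_Spaces.linear s s f" "Vector_Spaces.linear s s g"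
  shows "tmap s f g r \<in> tensor_square s"
proof -
  interpret T: vector_space "scale2 :: 'k \<Rightarrow> ('a, 'k) tensor2 \<Rightarrow> _" by (rule vector_space_scale2)
  have "tmap s f g (\<Sum>i\<in>I. tens2 s (a i) (b i)) = (\<Sum>i\<in>I. tmap s f g (tens2 s (a i) (b i)))"
    by (auto simp: tmap_def sum_fun_apply fun_eq_iff)
  then have "tmap s f g r = (\<Sum>i\<in>I. tens2 s (f (a i)) (g (b i)))"
    by (simp add: r_eq tmap_tens2[OF assms])
  then show ?thesis
    unfolding tensor_square_def by (force intro: T.span_sum T.span_base)
qed

text \<open>Evaluating the second leg of \<open>r\<close> instead of the first changes the sign, by skew-symmetry.\<close>

lemma sum_left_leg: "\<zeta> \<in> dual s \<Longrightarrow> (\<Sum>i\<in>I. s (\<zeta> (b i)) (a i)) = - sharp \<zeta>"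
proof (rule dual_separates)
  fix \<eta> assume *: "\<zeta> \<in> dual s" "\<eta> \<in> dual s"
  then have "\<eta> (\<Sum>i\<in>I. s (\<zeta> (b i)) (a i)) = \<zeta> (sharp \<eta>)"
    by (simp add: dual_sum sharp_def dual_linear mult.commute)
  then show "\<eta> (\<Sum>i\<in>I. s (\<zeta> (b i)) (a i)) = \<eta> (- sharp \<zeta>)"
    using * skew_sharp[of \<zeta> \<eta>] by (simp add: dual_linear)
qed

lemma sharp_add [simp]: "sharp (\<lambda>x. \<zeta> x + \<eta> x) = sharp \<zeta> + sharp \<eta>"
  and sharp_diff [simp]: "sharp (\<lambda>x. \<zeta> x - \<eta> x) = sharp \<zeta> - sharp \<eta>"
  and sharp_cmult [simp]: "sharp (\<lambda>x. c * \<zeta> x) = s c (sharp \<zeta>)"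
  by (simp_all add: sharp_def scale_left_distrib scale_left_diff_distrib sum.distrib sum_subtractf
      scale_sum_right)

lemma sharp_fun [simp]: "sharp (\<zeta> + \<eta>) = sharp \<zeta> + sharp \<eta>"
  "sharp (\<zeta> - \<eta>) = sharp \<zeta> - sharp \<eta>"
  "sharp (dual_scale c \<zeta>) = s c (sharp \<zeta>)"
  by (simp_all add: plus_fun_def fun_diff_def dual_scale_def)

end

locale skew_tensor_over_algebra = skew_tensor s I a b r + anti_pre_Poisson_UNIV s zin circ
  for s :: "'k::field \<Rightarrow> 'a::ab_group_add \<Rightarrow> 'a"
    and zin (infixl "\<^bold>*" 70) and circ (infixl "\<odot>" 70)
    and I :: "'i set" and a b r
begin

abbreviation "\<Delta> \<equiv> Delta_r s zin r"
abbreviation "\<delta> \<equiv> delta_r s circ r"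

lemma dual_ops:
  assumes "\<zeta> \<in> dual s"
  shows "(\<lambda>x. \<zeta> (u \<^bold>* x)) \<in> dual s" "(\<lambda>x. \<zeta> (x \<^bold>* u)) \<in> dual s"
    "(\<lambda>x. \<zeta> (u \<odot> x)) \<in> dual s" "(\<lambda>x. \<zeta> (x \<odot> u)) \<in> dual s"
    "(\<lambda>x. \<zeta> (star zin u x)) \<in> dual s" "(\<lambda>x. \<zeta> (bracket circ u x)) \<in> dual s"
  by (rule in_dualI; simp add: dual_linear[OF assms] star_def bracket_def algebra_simps)+

lemmas dual_simps = dual_linear dual_ops

lemma Delta_eval:
  assumes "\<zeta> \<in> dual s" "\<eta> \<in> dual s"
  shows "\<Delta> x \<zeta> \<eta> = \<zeta> (x \<^bold>* sharp \<eta>) - \<eta> (star zin x (sharp \<zeta>))"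
  using assms skew_sharp[of "\<lambda>z. \<zeta> (x \<^bold>* z)" \<eta>]
  by (simp add: Delta_r_def tmap_def r_eval dual_ops)

lemma delta_eval:
  assumes "\<zeta> \<in> dual s" "\<eta> \<in> dual s"
  shows "\<delta> x \<zeta> \<eta> = - \<zeta> (x \<odot> sharp \<eta>) - \<eta> (bracket circ x (sharp \<zeta>))"
  using assms skew_sharp[of "\<lambda>z. \<zeta> (x \<odot> z)" \<eta>]
  by (simp add: delta_r_def tmap_def r_eval dual_ops)

lemma tmap_eval: "\<zeta> \<in> dual s \<Longrightarrow> \<eta> \<in> dual s \<Longrightarrow>
    tmap s f g t \<zeta> \<eta> = t (\<lambda>x. \<zeta> (f x)) (\<lambda>x. \<eta> (g x))"
  by (simp add: tmap_def)

text \<open>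
  Skew-symmetry when each leg of \<open>r\<close> is hit by a multiplication operator, for the sixteen choices of
  the two operators. For given \<open>\<zeta>\<close> and \<open>\<eta>\<close> these are terminating rewrite rules: they bring each term
  of this kind to the form in which \<open>\<zeta>\<close> is outermost.
\<close>

lemmas sharp_mixed =
  skew_sharp[of "\<lambda>z. \<zeta> (v \<^bold>* z)" "\<lambda>z. \<eta> (u \<^bold>* z)"]
  skew_sharp[of "\<lambda>z. \<zeta> (v \<^bold>* z)" "\<lambda>z. \<eta> (z \<^bold>* u)"]
  skew_sharp[of "\<lambda>z. \<zeta> (v \<^bold>* z)" "\<lambda>z. \<eta> (u \<odot> z)"]
  skew_sharp[of "\<lambda>z. \<zeta> (v \<^bold>* z)" "\<lambda>z. \<eta> (z \<odot> u)"]
  skew_sharp[of "\<lambda>z. \<zeta> (z \<^bold>* v)" "\<lambda>z. \<eta> (u \<^bold>* z)"]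
  skew_sharp[of "\<lambda>z. \<zeta> (z \<^bold>* v)" "\<lambda>z. \<eta> (z \<^bold>* u)"]
  skew_sharp[of "\<lambda>z. \<zeta> (z \<^bold>* v)" "\<lambda>z. \<eta> (u \<odot> z)"]
  skew_sharp[of "\<lambda>z. \<zeta> (z \<^bold>* v)" "\<lambda>z. \<eta> (z \<odot> u)"]
  skew_sharp[of "\<lambda>z. \<zeta> (v \<odot> z)" "\<lambda>z. \<eta> (u \<^bold>* z)"]
  skew_sharp[of "\<lambda>z. \<zeta> (v \<odot> z)" "\<lambda>z. \<eta> (z \<^bold>* u)"]
  skew_sharp[of "\<lambda>z. \<zeta> (v \<odot> z)" "\<lambda>z. \<eta> (u \<odot> z)"]
  skew_sharp[of "\<lambda>z. \<zeta> (v \<odot> z)" "\<lambda>z. \<eta> (z \<odot> u)"]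
  skew_sharp[of "\<lambda>z. \<zeta> (z \<odot> v)" "\<lambda>z. \<eta> (u \<^bold>* z)"]
  skew_sharp[of "\<lambda>z. \<zeta> (z \<odot> v)" "\<lambda>z. \<eta> (z \<^bold>* u)"]
  skew_sharp[of "\<lambda>z. \<zeta> (z \<odot> v)" "\<lambda>z. \<eta> (u \<odot> z)"]
  skew_sharp[of "\<lambda>z. \<zeta> (z \<odot> v)" "\<lambda>z. \<eta> (z \<odot> u)"]
  for \<zeta> \<eta> u v

lemma Delta_outside: "\<zeta> \<notin> dual s \<or> \<eta> \<notin> dual s \<Longrightarrow> \<Delta> x \<zeta> \<eta> = 0"
  by (auto simp: Delta_r_def tmap_def)

lemma delta_outside: "\<zeta> \<notin> dual s \<or> \<eta> \<notin> dual s \<Longrightarrow> \<delta> x \<zeta> \<eta> = 0"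
  by (auto simp: delta_r_def tmap_def)

lemma tmap_outside: "\<zeta> \<notin> dual s \<or> \<eta> \<notin> dual s \<Longrightarrow> tmap s f g t \<zeta> \<eta> = 0"
  by (auto simp: tmap_def)

text \<open>Elements of the type of tensors are functions of arbitrary pairs, so equality also has to be
  checked at pairs that are not linear functionals, where everything below is 0.\<close>

lemma tensor2_ext:
  fixes t t' :: "('a, 'k) tensor2"
  assumes "\<And>\<zeta> \<eta>. \<zeta> \<in> dual s \<Longrightarrow> \<eta> \<in> dual s \<Longrightarrow> t \<zeta> \<eta> = t' \<zeta> \<eta>"
    and "\<And>\<zeta> \<eta>. \<zeta> \<notin> dual s \<or> \<eta> \<notin> dual s \<Longrightarrow> t \<zeta> \<eta> = t' \<zeta> \<eta>"
  shows "t = t'"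
  using assms by blast

lemmas outside = Delta_outside delta_outside tmap_outside tswap_def Let_def

lemmas eval = tmap_eval Delta_eval delta_eval tswap_def Let_def star_def bracket_def

section \<open>The compatibility conditions\<close>

context
  fixes x y :: 'a and \<zeta> \<eta> :: "'a \<Rightarrow> 'k"
  assumes dual_\<zeta>: "\<zeta> \<in> dual s" and dual_\<eta>: "\<eta> \<in> dual s"
begin

text \<open>Each condition is paired with \<open>\<zeta> \<otimes> \<eta>\<close>. Functionals applied to sums are expanded, so that
  \<open>pairing_rules\<close> reduces both sides to combinations of \<open>\<zeta>\<close> and \<open>\<eta>\<close> applied to reduced products of
  degree three and of mixed terms, which are then compared.\<close>

lemmas pairing_rules = dual_\<zeta> dual_\<eta> dual_closed dual_simps[OF dual_\<zeta>] dual_simps[OF dual_\<eta>] eval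
  degree_three[where x = x and y = y and z = "sharp \<zeta>"]
  degree_three[where x = x and y = y and z = "sharp \<eta>"]
  sharp_mixed[where \<zeta> = \<zeta> and \<eta> = \<eta> and u = x and v = y]
  sharp_mixed[where \<zeta> = \<zeta> and \<eta> = \<eta> and u = y and v = x]

lemma pairing_bialg1:
  "\<Delta> (star zin x y) \<zeta> \<eta>
    = (tmap s id (star zin x) (\<Delta> y) - tmap s (zin y) id (\<Delta> x)) \<zeta> \<eta>"
  by (simp add: pairing_rules algebra_simps)

lemma pairing_bialg2:
  "(\<Delta> (x \<^bold>* y) + tswap (\<Delta> (x \<^bold>* y))) \<zeta> \<eta>
    = (tmap s (zin x) id (\<Delta> y + tswap (\<Delta> y)) - tmap s id (\<lambda>z. z \<^bold>* y) (\<Delta> x)) \<zeta> \<eta>"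
  by (simp add: pairing_rules algebra_simps)

lemma pairing_bialg3:
  "\<delta> (bracket circ x y) \<zeta> \<eta>
    = ((tmap s id (bracket circ x) (\<delta> y) - tmap s (circ x) id (\<delta> y))
        - (tmap s id (bracket circ y) (\<delta> x) - tmap s (circ y) id (\<delta> x))) \<zeta> \<eta>"
  by (simp add: pairing_rules algebra_simps)

lemma pairing_bialg4:
  "(let t = \<delta> (x \<odot> y) - tmap s (circ x) id (\<delta> y) - tmap s id (circ x) (\<delta> y)
            + tmap s id (\<lambda>z. z \<odot> y) (\<delta> x)
      in t - tswap t) \<zeta> \<eta>
    = 0 \<zeta> \<eta>"
  by (simp add: pairing_rules algebra_simps)

lemma pairing_bialg5:
  "\<delta> (star zin x y) \<zeta> \<eta>
    = (tmap s id (star zin x) (\<delta> y) + tmap s id (star zin y) (\<delta> x)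
        + tmap s (circ x) id (\<Delta> y) + tmap s (circ y) id (\<Delta> x)) \<zeta> \<eta>"
  by (simp add: pairing_rules algebra_simps)

lemma pairing_bialg6:
  "\<Delta> (bracket circ x y) \<zeta> \<eta>
    = (- tmap s (circ x) id (\<Delta> y) - tmap s id (star zin y) (\<delta> x)
        - tmap s (zin y) id (\<delta> x) + tmap s id (bracket circ x) (\<Delta> y)) \<zeta> \<eta>"
  by (simp add: pairing_rules algebra_simps)

lemma pairing_bialg7:
  "(\<Delta> (x \<odot> y) + tswap (\<Delta> (x \<odot> y))) \<zeta> \<eta>
    = (let t = tmap s (circ x) id (\<Delta> y) + tmap s id (circ x) (\<Delta> y)
            + tmap s id (\<lambda>z. z \<^bold>* y) (\<delta> x)
         in t + tswap t) \<zeta> \<eta>"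
  by (simp add: pairing_rules algebra_simps)

lemma pairing_bialg8:
  "(\<delta> (x \<^bold>* y) - tswap (\<delta> (x \<^bold>* y))) \<zeta> \<eta>
    = (tmap s id (zin x) (\<delta> y) - tswap (tmap s (zin x) id (\<delta> y))
        - tmap s (circ x) id (\<Delta> y) - tswap (tmap s id (circ x) (\<Delta> y))
        - tmap s id (\<lambda>z. z \<^bold>* y) (\<delta> x) - tswap (tmap s id (\<lambda>z. z \<odot> y) (\<Delta> x))) \<zeta> \<eta>"
  by (simp add: pairing_rules algebra_simps)

end

section \<open>The comultiplications and their dual operations\<close>

lemma linear_comultiplicationI:
  fixes D :: "'a \<Rightarrow> ('a, 'k) tensor2"
  assumes add: "\<And>x y \<zeta> \<eta>. \<zeta> \<in> dual s \<Longrightarrow> \<eta> \<in> dual s \<Longrightarrow> D (x + y) \<zeta> \<eta> = D x \<zeta> \<eta> + D y \<zeta> \<eta>"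
    and scale: "\<And>c x \<zeta> \<eta>. \<zeta> \<in> dual s \<Longrightarrow> \<eta> \<in> dual s \<Longrightarrow> D (s c x) \<zeta> \<eta> = c * D x \<zeta> \<eta>"
    and outside: "\<And>x \<zeta> \<eta>. \<zeta> \<notin> dual s \<or> \<eta> \<notin> dual s \<Longrightarrow> D x \<zeta> \<eta> = 0"
  shows "Vector_Spaces.linear s scale2 D"
  unfolding Vector_Spaces.linear_iff
proof (intro conjI allI)
  show "D (x + y) = D x + D y" for x y
    by (rule tensor2_ext) (simp_all add: add outside)
  show "D (s c x) = scale2 c (D x)" for c x
    by (rule tensor2_ext) (simp_all add: scale outside scale2_def)
qed (fact vector_space_axioms vector_space_scale2)+

lemma linear_Delta: "Vector_Spaces.linear s scale2 \<Delta>"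
proof (rule linear_comultiplicationI)
  fix \<zeta> \<eta> assume dual: "\<zeta> \<in> dual s" "\<eta> \<in> dual s"
  note rules = dual eval dual_linear[OF dual(1)] dual_linear[OF dual(2)] algebra_simps
  show "\<Delta> (x + y) \<zeta> \<eta> = \<Delta> x \<zeta> \<eta> + \<Delta> y \<zeta> \<eta>" "\<Delta> (s c x) \<zeta> \<eta> = c * \<Delta> x \<zeta> \<eta>" for c x y
    by (simp_all add: rules)
qed (rule Delta_outside)

lemma linear_delta: "Vector_Spaces.linear s scale2 \<delta>"
proof (rule linear_comultiplicationI)
  fix \<zeta> \<eta> assume dual: "\<zeta> \<in> dual s" "\<eta> \<in> dual s"
  note rules = dual eval dual_linear[OF dual(1)] dual_linear[OF dual(2)] algebra_simps
  show "\<delta> (x + y) \<zeta> \<eta> = \<delta> x \<zeta> \<eta> + \<delta> y \<zeta> \<eta>" "\<delta> (s c x) \<zeta> \<eta> = c * \<delta> x \<zeta> \<eta>" for c x y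
    by (simp_all add: rules)
qed (rule delta_outside)

lemma linear_ops:
  "Vector_Spaces.linear s s id" "Vector_Spaces.linear s s (zin x)"
  "Vector_Spaces.linear s s (circ x)" "Vector_Spaces.linear s s (star zin x)"
  "Vector_Spaces.linear s s (bracket circ x)"
  by (simp_all add: Vector_Spaces.linear_iff vector_space_axioms star_def bracket_def
      scale_right_distrib scale_right_diff_distrib)

lemma Delta_in_tensor_square: "\<Delta> x \<in> tensor_square s"
proof -
  interpret T: vector_space "scale2 :: 'k \<Rightarrow> ('a, 'k) tensor2 \<Rightarrow> _" by (rule vector_space_scale2)
  show ?thesis
    unfolding Delta_r_def tensor_square_def
    by (intro T.span_neg T.span_add tmap_r_in_tensor_square[unfolded tensor_square_def] linear_ops)
qed

lemma delta_in_tensor_square: "\<delta> x \<in> tensor_square s"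
proof -
  interpret T: vector_space "scale2 :: 'k \<Rightarrow> ('a, 'k) tensor2 \<Rightarrow> _" by (rule vector_space_scale2)
  show ?thesis
    unfolding delta_r_def tensor_square_def
    by (intro T.span_diff tmap_r_in_tensor_square[unfolded tensor_square_def] linear_ops)
qed

lemma dual_op_Delta:
  "\<zeta> \<in> dual s \<Longrightarrow> \<eta> \<in> dual s \<Longrightarrow> dual_op \<Delta> \<zeta> \<eta> x = \<zeta> (x \<^bold>* sharp \<eta>) - \<eta> (star zin x (sharp \<zeta>))"
  by (simp add: dual_op_def Delta_eval)

lemma dual_op_delta:
  "\<zeta> \<in> dual s \<Longrightarrow> \<eta> \<in> dual s \<Longrightarrow>
    dual_op \<delta> \<zeta> \<eta> x = - \<zeta> (x \<odot> sharp \<eta>) - \<eta> (bracket circ x (sharp \<zeta>))"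
  by (simp add: dual_op_def delta_eval)

lemma dual_op_closed:
  assumes "\<zeta> \<in> dual s" "\<eta> \<in> dual s"
  shows "dual_op \<Delta> \<zeta> \<eta> \<in> dual s" "dual_op \<delta> \<zeta> \<eta> \<in> dual s"
  using assms
  by (auto intro!: in_dualI simp: dual_op_Delta dual_op_delta star_def bracket_def
      dual_linear[OF assms(1)] dual_linear[OF assms(2)] algebra_simps)

section \<open>The Yang-Baxter equation makes the operator multiplicative\<close>

lemma dual_product_sums:
  assumes "\<theta> \<in> dual s"
  shows "\<theta> ((\<Sum>i\<in>I. s (p i) (u i)) \<^bold>* (\<Sum>j\<in>J. s (q j) (v j)))
      = (\<Sum>i\<in>I. \<Sum>j\<in>J. p i * q j * \<theta> (u i \<^bold>* v j))"
    and "\<theta> ((\<Sum>i\<in>I. s (p i) (u i)) \<odot> (\<Sum>j\<in>J. s (q j) (v j)))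
      = (\<Sum>i\<in>I. \<Sum>j\<in>J. p i * q j * \<theta> (u i \<odot> v j))"
  by (simp_all add: zin.mul_sum circ.mul_sum dual_sum[OF assms] dual_linear[OF assms])

text \<open>In each of the three kinds of summands two of the three functionals are evaluated at single legs
  and the third at a product. Evaluating at \<open>a i\<close> turns \<open>b i\<close> into a value of \<open>sharp\<close>; evaluating at
  \<open>b i\<close> turns \<open>a i\<close> into minus such a value.\<close>

lemma YB_D_eval:
  assumes \<zeta>: "\<zeta> \<in> dual s" and \<eta>: "\<eta> \<in> dual s" and \<theta>: "\<theta> \<in> dual s"
  shows "YB_D s zin I a b \<zeta> \<eta> \<theta>
    = \<theta> (star zin (sharp \<zeta>) (sharp \<eta>)) - \<eta> (sharp \<zeta> \<^bold>* sharp \<theta>) - \<zeta> (sharp \<eta> \<^bold>* sharp \<theta>)"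
proof -
  have 1: "\<eta> (sharp \<zeta> \<^bold>* sharp \<theta>) = - (\<Sum>i\<in>I. \<Sum>j\<in>I. \<zeta> (a i) * \<theta> (b j) * \<eta> (b i \<^bold>* a j))"
    unfolding dual_product_sums(1)[OF \<eta>, symmetric] sum_left_leg[OF \<theta>] sharp_def[of \<zeta>, symmetric]
    by (simp add: dual_linear[OF \<eta>])
  have 2: "\<zeta> (sharp \<eta> \<^bold>* sharp \<theta>) = (\<Sum>i\<in>I. \<Sum>j\<in>I. \<eta> (b i) * \<theta> (b j) * \<zeta> (a i \<^bold>* a j))"
    unfolding dual_product_sums(1)[OF \<zeta>, symmetric] sum_left_leg[OF \<theta>] sum_left_leg[OF \<eta>]
    by (simp add: dual_linear[OF \<zeta>])
  have 3: "\<theta> (sharp \<zeta> \<^bold>* sharp \<eta>) = (\<Sum>i\<in>I. \<Sum>j\<in>I. \<zeta> (a i) * \<eta> (a j) * \<theta> (b i \<^bold>* b j))"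
    "\<theta> (sharp \<eta> \<^bold>* sharp \<zeta>) = (\<Sum>i\<in>I. \<Sum>j\<in>I. \<eta> (a j) * \<zeta> (a i) * \<theta> (b j \<^bold>* b i))"
    unfolding sharp_def by (simp_all add: dual_product_sums(1)[OF \<theta>], rule sum.swap)
  show ?thesis
    by (simp add: YB_D_def sum_fun_apply tens3_def assms dual_linear[OF \<theta>] star_def 1 2 3
        sum.distrib sum_subtractf algebra_simps)
qed

lemma YB_S_eval:
  assumes \<zeta>: "\<zeta> \<in> dual s" and \<eta>: "\<eta> \<in> dual s" and \<theta>: "\<theta> \<in> dual s"
  shows "YB_S s circ I a b \<zeta> \<eta> \<theta>
    = \<zeta> (sharp \<eta> \<odot> sharp \<theta>) - \<eta> (sharp \<zeta> \<odot> sharp \<theta>) - \<theta> (bracket circ (sharp \<zeta>) (sharp \<eta>))"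
proof -
  have 1: "\<eta> (sharp \<zeta> \<odot> sharp \<theta>) = - (\<Sum>i\<in>I. \<Sum>j\<in>I. \<zeta> (a i) * \<theta> (b j) * \<eta> (b i \<odot> a j))"
    unfolding dual_product_sums(2)[OF \<eta>, symmetric] sum_left_leg[OF \<theta>] sharp_def[of \<zeta>, symmetric]
    by (simp add: dual_linear[OF \<eta>])
  have 2: "\<zeta> (sharp \<eta> \<odot> sharp \<theta>) = (\<Sum>i\<in>I. \<Sum>j\<in>I. \<eta> (b i) * \<theta> (b j) * \<zeta> (a i \<odot> a j))"
    unfolding dual_product_sums(2)[OF \<zeta>, symmetric] sum_left_leg[OF \<theta>] sum_left_leg[OF \<eta>]
    by (simp add: dual_linear[OF \<zeta>])
  have 3: "\<theta> (sharp \<zeta> \<odot> sharp \<eta>) = (\<Sum>i\<in>I. \<Sum>j\<in>I. \<zeta> (a i) * \<eta> (a j) * \<theta> (b i \<odot> b j))"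
    "\<theta> (sharp \<eta> \<odot> sharp \<zeta>) = (\<Sum>i\<in>I. \<Sum>j\<in>I. \<eta> (a j) * \<zeta> (a i) * \<theta> (b j \<odot> b i))"
    unfolding sharp_def by (simp_all add: dual_product_sums(2)[OF \<theta>], rule sum.swap)
  show ?thesis
    by (simp add: YB_S_def sum_fun_apply tens3_def assms dual_linear[OF \<theta>] bracket_def 1 2 3
        sum.distrib sum_subtractf algebra_simps)
qed

end

locale coboundary_Yang_Baxter = skew_tensor_over_algebra s zin circ I a b r
  for s :: "'k::field \<Rightarrow> 'a::ab_group_add \<Rightarrow> 'a"
    and zin (infixl "\<^bold>*" 70) and circ (infixl "\<odot>" 70)
    and I :: "'i set" and a b r +
  assumes YB_S: "YB_S s circ I a b = 0" and YB_D: "YB_D s zin I a b = 0"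
begin

text \<open>By skew-symmetry \<open>\<langle>sharp(\<zeta> \<ast> \<eta>), \<theta>\<rangle> = - \<langle>\<zeta> \<ast> \<eta>, sharp \<theta>\<rangle>\<close>. The right side consists of two of the
  three terms of \<open>D(r)\<close> at \<open>\<zeta> \<otimes> \<theta> \<otimes> \<eta>\<close>, and the third is \<open>- \<langle>sharp \<zeta> \<ast> sharp \<eta>, \<theta>\<rangle>\<close>. The same argument
  with \<open>S(r)\<close> applies to \<open>\<circ>\<close>.\<close>

lemma sharp_dual_op_Delta:
  assumes "\<zeta> \<in> dual s" "\<eta> \<in> dual s"
  shows "sharp (dual_op \<Delta> \<zeta> \<eta>) = sharp \<zeta> \<^bold>* sharp \<eta>"
proof (rule dual_separates)
  fix \<theta> assume \<theta>: "\<theta> \<in> dual s"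
  have "\<theta> (sharp (dual_op \<Delta> \<zeta> \<eta>)) = - dual_op \<Delta> \<zeta> \<eta> (sharp \<theta>)"
    using assms \<theta> by (intro skew_sharp dual_op_closed)
  also have "\<dots> = \<theta> (sharp \<zeta> \<^bold>* sharp \<eta>)"
    using YB_D_eval[OF assms(1) \<theta> assms(2)] YB_D assms
    by (simp add: dual_op_Delta star_def add.commute algebra_simps)
  finally show "\<theta> (sharp (dual_op \<Delta> \<zeta> \<eta>)) = \<theta> (sharp \<zeta> \<^bold>* sharp \<eta>)" .
qed

lemma sharp_dual_op_delta:
  assumes "\<zeta> \<in> dual s" "\<eta> \<in> dual s"
  shows "sharp (dual_op \<delta> \<zeta> \<eta>) = sharp \<zeta> \<odot> sharp \<eta>"
proof (rule dual_separates)
  fix \<theta> assume \<theta>: "\<theta> \<in> dual s"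
  have "\<theta> (sharp (dual_op \<delta> \<zeta> \<eta>)) = - dual_op \<delta> \<zeta> \<eta> (sharp \<theta>)"
    using assms \<theta> by (intro skew_sharp dual_op_closed)
  also have "\<dots> = \<theta> (sharp \<zeta> \<odot> sharp \<eta>)"
    using YB_S_eval[OF assms(1) \<theta> assms(2)] YB_S assms
    by (simp add: dual_op_delta bracket_def dual_linear algebra_simps)
  finally show "\<theta> (sharp (dual_op \<delta> \<zeta> \<eta>)) = \<theta> (sharp \<zeta> \<odot> sharp \<eta>)" .
qed

section \<open>The dual space is an anti-pre-Poisson algebra\<close>

lemmas dual_rules = dual_op_Delta dual_op_delta dual_op_closed dual_closed
  sharp_dual_op_Delta sharp_dual_op_delta

context
  fixes \<zeta> \<eta> \<theta> :: "'a \<Rightarrow> 'k"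
  assumes duals: "\<zeta> \<in> dual s" "\<eta> \<in> dual s" "\<theta> \<in> dual s"
begin

lemmas triple_rules = duals dual_rules dual_linear[OF duals(1)] dual_linear[OF duals(2)]
  dual_linear[OF duals(3)] star_def bracket_def

text \<open>An axiom for three functionals, paired with \<open>x\<close>, applies each functional to products of \<open>x\<close> with the
  images of the other two.\<close>

lemmas triple_degree_three =
  degree_three[where x = x and y = "sharp \<zeta>" and z = "sharp \<eta>"]
  degree_three[where x = x and y = "sharp \<zeta>" and z = "sharp \<theta>"]
  degree_three[where x = x and y = "sharp \<eta>" and z = "sharp \<theta>"]
  for x

lemma dual_zin1:
  "dual_op \<Delta> \<zeta> (dual_op \<Delta> \<eta> \<theta>) = - dual_op \<Delta> (dual_op \<Delta> \<zeta> \<eta> + dual_op \<Delta> \<eta> \<zeta>) \<theta>"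
  by (rule ext) (simp add: triple_rules triple_degree_three algebra_simps)

lemma dual_zin2:
  "- dual_op \<Delta> (dual_op \<Delta> \<zeta> \<eta> + dual_op \<Delta> \<eta> \<zeta>) \<theta> = - dual_op \<Delta> (dual_op \<Delta> \<theta> \<eta> + dual_op \<Delta> \<eta> \<theta>) \<zeta>"
  by (rule ext) (simp add: triple_rules triple_degree_three algebra_simps)

lemma dual_zin3:
  "- dual_op \<Delta> (dual_op \<Delta> \<theta> \<eta> + dual_op \<Delta> \<eta> \<theta>) \<zeta> = dual_op \<Delta> \<theta> (dual_op \<Delta> \<eta> \<zeta>)"
  by (rule ext) (simp add: triple_rules triple_degree_three algebra_simps)

lemma dual_zin4:
  "dual_op \<Delta> \<theta> (dual_op \<Delta> \<zeta> \<eta>) = dual_op \<Delta> \<zeta> (dual_op \<Delta> \<theta> \<eta>)"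
  by (rule ext) (simp add: triple_rules triple_degree_three algebra_simps)

lemma dual_apl1:
  "dual_op \<delta> \<zeta> (dual_op \<delta> \<eta> \<theta>) - dual_op \<delta> \<eta> (dual_op \<delta> \<zeta> \<theta>)
    = dual_op \<delta> (bracket (dual_op \<delta>) \<eta> \<zeta>) \<theta>"
  by (rule ext) (simp add: triple_rules triple_degree_three algebra_simps)

lemma dual_apl2:
  "dual_op \<delta> (bracket (dual_op \<delta>) \<zeta> \<eta>) \<theta> + dual_op \<delta> (bracket (dual_op \<delta>) \<eta> \<theta>) \<zeta>
    + dual_op \<delta> (bracket (dual_op \<delta>) \<theta> \<zeta>) \<eta> = 0"
  by (rule ext) (simp add: triple_rules triple_degree_three algebra_simps)

lemma dual_app1:
  "dual_op \<Delta> (dual_op \<delta> \<zeta> \<eta> - dual_op \<delta> \<eta> \<zeta>) \<theta>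
    = dual_op \<Delta> \<eta> (dual_op \<delta> \<zeta> \<theta>) - dual_op \<delta> \<zeta> (dual_op \<Delta> \<eta> \<theta>)"
  by (rule ext) (simp add: triple_rules triple_degree_three algebra_simps)

lemma dual_app2:
  "dual_op \<delta> (dual_op \<Delta> \<zeta> \<eta> + dual_op \<Delta> \<eta> \<zeta>) \<theta>
    = - dual_op \<Delta> \<zeta> (dual_op \<delta> \<eta> \<theta>) - dual_op \<Delta> \<eta> (dual_op \<delta> \<zeta> \<theta>)"
  by (rule ext) (simp add: triple_rules triple_degree_three algebra_simps)

lemma dual_app3:
  "dual_op \<delta> \<theta> (dual_op \<Delta> \<zeta> \<eta> + dual_op \<Delta> \<eta> \<zeta>) + dual_op \<Delta> \<zeta> (dual_op \<delta> \<eta> \<theta>)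
      + dual_op \<Delta> \<eta> (dual_op \<delta> \<zeta> \<theta>)
    = dual_op \<Delta> \<zeta> (dual_op \<delta> \<theta> \<eta>) + dual_op \<Delta> \<eta> (dual_op \<delta> \<theta> \<zeta>)"
  by (rule ext) (simp add: triple_rules triple_degree_three algebra_simps)

end

lemma dual_bilinear:
  assumes "\<zeta> \<in> dual s" "\<eta> \<in> dual s" "\<theta> \<in> dual s"
  shows "dual_op \<Delta> (\<zeta> + \<eta>) \<theta> = dual_op \<Delta> \<zeta> \<theta> + dual_op \<Delta> \<eta> \<theta>"
    "dual_op \<Delta> \<zeta> (\<eta> + \<theta>) = dual_op \<Delta> \<zeta> \<eta> + dual_op \<Delta> \<zeta> \<theta>"
    "dual_op \<Delta> (dual_scale c \<zeta>) \<eta> = dual_scale c (dual_op \<Delta> \<zeta> \<eta>)"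
    "dual_op \<Delta> \<zeta> (dual_scale c \<eta>) = dual_scale c (dual_op \<Delta> \<zeta> \<eta>)"
    "dual_op \<delta> (\<zeta> + \<eta>) \<theta> = dual_op \<delta> \<zeta> \<theta> + dual_op \<delta> \<eta> \<theta>"
    "dual_op \<delta> \<zeta> (\<eta> + \<theta>) = dual_op \<delta> \<zeta> \<eta> + dual_op \<delta> \<zeta> \<theta>"
    "dual_op \<delta> (dual_scale c \<zeta>) \<eta> = dual_scale c (dual_op \<delta> \<zeta> \<eta>)"
    "dual_op \<delta> \<zeta> (dual_scale c \<eta>) = dual_scale c (dual_op \<delta> \<zeta> \<eta>)"
  by (rule ext; simp add: triple_rules[OF assms] dual_scale_closed dual_scale_apply algebra_simps)+

lemma dual_algebra: "anti_pre_Poisson_algebra dual_scale (dual s) (dual_op \<Delta>) (dual_op \<delta>)"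
  by (intro anti_pre_Poisson_algebra.intro anti_pre_Poisson_algebra_axioms.intro
      anti_Zinbiel_algebra.intro anti_Zinbiel_algebra_axioms.intro
      anti_pre_Lie_algebra.intro anti_pre_Lie_algebra_axioms.intro
      bilinear_algebra.intro bilinear_algebra_axioms.intro
      vector_space_dual_scale subspace_dual dual_op_closed dual_bilinear
      dual_zin1 dual_zin2 dual_zin3 dual_zin4 dual_apl1 dual_apl2 dual_app1 dual_app2 dual_app3)

section \<open>The bialgebra\<close>

theorem coboundary_bialgebra: "anti_pre_Poisson_bialgebra s zin circ \<Delta> \<delta>"
proof (intro anti_pre_Poisson_bialgebra.intro)
  note pairing_bialg = pairing_bialg1 pairing_bialg2 pairing_bialg3 pairing_bialg4
    pairing_bialg5 pairing_bialg6 pairing_bialg7 pairing_bialg8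
  show "anti_pre_Poisson_algebra s UNIV zin circ"
    by (rule anti_pre_Poisson_algebra_axioms)
  show "anti_pre_Poisson_coalgebra s \<Delta> \<delta>"
    by (intro anti_pre_Poisson_coalgebra.intro linear_Delta linear_delta
        Delta_in_tensor_square delta_in_tensor_square dual_algebra)
  show "anti_pre_Poisson_bialgebra_axioms s zin circ \<Delta> \<delta>"
    by (rule anti_pre_Poisson_bialgebra_axioms.intro; (unfold Let_def)?; rule tensor2_ext;
        (rule pairing_bialg[unfolded Let_def]; assumption | auto simp: outside))
qed

end

theorem theorem3p22:
  fixes s :: "'k::field \<Rightarrow> 'a::ab_group_add \<Rightarrow> 'a"
    and Basis :: "'a set"
    and zin circ :: "'a \<Rightarrow> 'a \<Rightarrow> 'a"
    and r :: "('a, 'k) tensor2"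
    and I :: "'i set" and a b :: "'i \<Rightarrow> 'a"
  assumes "finite_dimensional_vector_space s Basis"
    and "anti_pre_Poisson_algebra s UNIV zin circ"
    and "finite I" and "r = (\<Sum>i\<in>I. tens2 s (a i) (b i))"
    and "tswap r = - r"
    and "YB_S s circ I a b = 0" and "YB_D s zin I a b = 0"
  shows "anti_pre_Poisson_bialgebra s zin circ (Delta_r s zin r) (delta_r s circ r)"
proof (rule coboundary_Yang_Baxter.coboundary_bialgebra)
  have "vector_space s"
    using assms(1) by (rule finite_dimensional_vector_space.axioms(1))
  with assms(2-) show "coboundary_Yang_Baxter s zin circ I a b r"
    by (intro coboundary_Yang_Baxter.intro coboundary_Yang_Baxter_axioms.intro
        skew_tensor_over_algebra.intro skew_tensor.intro skew_tensor_axioms.intro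
        anti_pre_Poisson_UNIV.intro)
qed

end
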